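(* Let $p\in\mathbb{SP}$ be such that for every $q\le p$ in $\mathbb{SP}$, for all but finitely many $\ell\in\omega$ and all $t\in\mathrm{Lev}_\ell(q)$ one has $|t^{-1}\{1\}|<(\log_2\ell)^2$. Then the forcing $\mathbb{SP}$ below $p$ (i.e. $\{q\in\mathbb{SP}:q\le p\}$) does not have the Sacks property.
   Context: A tree $p\subseteq2^{<\omega}$ (nonempty and closed under initial segments) is a splitting tree, $p\in\mathbb{SP}$, if for every $t\in p$ there is $k\in\omega$ such that for every $n\ge k$ and every $i\in\{0,1\}$ there is $t'\in p$ with $t\trianglelefteq t'$ and $t'(n)=i$, where $\trianglelefteq$ is the initial segment relation. $\mathbb{SP}$ is ordered by inclusion: $q\le p$ iff $q\subseteq p$. $\mathrm{Lev}_\ell(q)=\{t\in q:|t|=\ell\}$ and $t^{-1}\{1\}=\{i<|t|:t(i)=1\}$. For $f:\omega\to\omega\setminus\{0\}$, an $f$-slalom is a sequence $\langle S_n:n<\omega\rangle$ of sets $S_n\subseteq\omega$ with $|S_n|\le f(n)$. A forcing $\mathbb{P}$ has the Sacks property if for every $f:\omega\to\omega\setminus\{0\}$ with $\lim_nf(n)=\infty$, every $\mathbb{P}$-name $\tau$ for a real (element of $\omega^\omega$) and every condition $r\in\mathbb{P}$ there are an $f$-slalom $\langle S_n:n<\omega\rangle$ (in the ground model) and $q\le r$ with $q\Vdash(\forall^\infty n)\,\tau(n)\in S_n$, where $\forall^\infty n$ means "for all but finitely many $n$". *)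

theory Defs
  imports Complex_Main "HOL-Library.Sublist"
begin

section \<open>Splitting trees\<close>

text \<open>Finite binary sequences are Boolean lists, with \<open>True\<close> for $1$ and \<open>False\<close> for $0$.\<close>

definition is_tree :: "bool list set \<Rightarrow> bool" where
  "is_tree p \<longleftrightarrow> p \<noteq> {} \<and> (\<forall>t\<in>p. \<forall>s. prefix s t \<longrightarrow> s \<in> p)"

definition SP :: "bool list set set" where
  "SP = {p. is_tree p \<and>
     (\<forall>t\<in>p. \<exists>k. \<forall>n\<ge>k. \<forall>i. \<exists>t'\<in>p. prefix t t' \<and> n < length t' \<and> t' ! n = i)}"

definition Lev :: "nat \<Rightarrow> bool list set \<Rightarrow> bool list set" where
  "Lev l q = {t \<in> q. length t = l}"

definition ones :: "bool list \<Rightarrow> nat set" where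
  "ones t = {i. i < length t \<and> t ! i = True}"

section \<open>Forcing statements about reals\<close>

text \<open>
  A forcing is given by its set \<open>P\<close> of conditions and its order \<open>le\<close> (smaller is stronger).
  The ground model is the ambient universe. The forcing relation is embedded shallowly: a sentence
  of the forcing language is identified with the predicate on conditions saying which of them
  force it, and each operation below is the corresponding clause of the usual recursive definition
  of the forcing relation. In the two quantifiers the range \<open>A\<close> is a set of the ground model,
  that is, they quantify over its check-name.
\<close>

definition forces_Not ::
  "'p set \<Rightarrow> ('p \<Rightarrow> 'p \<Rightarrow> bool) \<Rightarrow> ('p \<Rightarrow> bool) \<Rightarrow> 'p \<Rightarrow> bool" where
  "forces_Not P le \<phi> q \<longleftrightarrow> (\<forall>r\<in>P. le r q \<longrightarrow> \<not> \<phi> r)"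

definition forces_And :: "('p \<Rightarrow> bool) \<Rightarrow> ('p \<Rightarrow> bool) \<Rightarrow> 'p \<Rightarrow> bool" where
  "forces_And \<phi> \<psi> q \<longleftrightarrow> \<phi> q \<and> \<psi> q"

definition forces_Ball :: "'a set \<Rightarrow> ('a \<Rightarrow> 'p \<Rightarrow> bool) \<Rightarrow> 'p \<Rightarrow> bool" where
  "forces_Ball A \<phi> q \<longleftrightarrow> (\<forall>x\<in>A. \<phi> x q)"

definition forces_Bex ::
  "'p set \<Rightarrow> ('p \<Rightarrow> 'p \<Rightarrow> bool) \<Rightarrow> 'a set \<Rightarrow> ('a \<Rightarrow> 'p \<Rightarrow> bool) \<Rightarrow> 'p \<Rightarrow> bool" where
  "forces_Bex P le A \<phi> q \<longleftrightarrow> (\<forall>r\<in>P. le r q \<longrightarrow> (\<exists>s\<in>P. le s r \<and> (\<exists>x\<in>A. \<phi> x s)))"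

text \<open>
  Names for reals are nice names: sets of pairs of (the check-name of) an ordered pair
  \<open>(n, m)\<close> and a condition. Every name for a real is forced to be equal to a name of this form.
  With \<open>G\<close> generic, such a \<open>\<tau>\<close> is evaluated as
  \<open>{(n, m). \<exists>u\<in>G. ((n, m), u) \<in> \<tau>}\<close>, so that \<open>forces_value\<close> is the clause for the
  atomic sentence \<open>(n, m) \<in> \<tau>\<close>, i.e. \<open>\<tau>(n) = m\<close>.
\<close>

type_synonym 'p nice_name = "((nat \<times> nat) \<times> 'p) set"

definition forces_value ::
  "'p set \<Rightarrow> ('p \<Rightarrow> 'p \<Rightarrow> bool) \<Rightarrow> 'p nice_name \<Rightarrow> nat \<Rightarrow> nat \<Rightarrow> 'p \<Rightarrow> bool" where
  "forces_value P le \<tau> n m q \<longleftrightarrow>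
     (\<forall>r\<in>P. le r q \<longrightarrow> (\<exists>s\<in>P. le s r \<and> (\<exists>u\<in>P. le s u \<and> ((n, m), u) \<in> \<tau>)))"

text \<open>Every condition forces that \<open>\<tau>\<close> is a total function from $\omega$ to $\omega$.\<close>

definition real_name :: "'p set \<Rightarrow> ('p \<Rightarrow> 'p \<Rightarrow> bool) \<Rightarrow> 'p nice_name \<Rightarrow> bool" where
  "real_name P le \<tau> \<longleftrightarrow> \<tau> \<subseteq> UNIV \<times> P \<and>
     (\<forall>q\<in>P.
        forces_Ball UNIV (\<lambda>n. forces_Bex P le UNIV (\<lambda>m. forces_value P le \<tau> n m)) q \<and>
        forces_Ball UNIV (\<lambda>n. forces_Ball {(m, m'). m \<noteq> m'} (\<lambda>(m, m').
          forces_Not P le (forces_And (forces_value P le \<tau> n m) (forces_value P le \<tau> n m')))) q)"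

text \<open>The sentence \<open>(\<exists>N) (\<forall>n \<ge> N) (\<exists>m \<in> S n) \<tau>(n) = m\<close>.\<close>

definition forces_almost_all_in ::
  "'p set \<Rightarrow> ('p \<Rightarrow> 'p \<Rightarrow> bool) \<Rightarrow> 'p nice_name \<Rightarrow> (nat \<Rightarrow> nat set) \<Rightarrow> 'p \<Rightarrow> bool" where
  "forces_almost_all_in P le \<tau> S =
     forces_Bex P le UNIV (\<lambda>N. forces_Ball {N..} (\<lambda>n.
       forces_Bex P le (S n) (\<lambda>m. forces_value P le \<tau> n m)))"

section \<open>The Sacks property\<close>

definition slalom :: "(nat \<Rightarrow> nat) \<Rightarrow> (nat \<Rightarrow> nat set) \<Rightarrow> bool" where
  "slalom f S \<longleftrightarrow> (\<forall>n. finite (S n) \<and> card (S n) \<le> f n)"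

definition Sacks_property :: "'p set \<Rightarrow> ('p \<Rightarrow> 'p \<Rightarrow> bool) \<Rightarrow> bool" where
  "Sacks_property P le \<longleftrightarrow>
     (\<forall>f \<tau> r. (\<forall>n. f n \<noteq> 0) \<and> filterlim f at_top sequentially \<and> real_name P le \<tau> \<and> r \<in> P \<longrightarrow>
        (\<exists>S q. slalom f S \<and> q \<in> P \<and> le q r \<and> forces_almost_all_in P le \<tau> S q))"

end

theory Submission
  imports Defs "HOL-Library.Countable" "HOL-Real_Asymp.Real_Asymp"
begin

text \<open>
  The witness is the function sending \<open>n\<close> to the initial segment of length \<open>2 ^ n\<close> of the generic
  branch. If a condition \<open>s\<close> captures it in a slalom of width \<open>n + 1\<close>, then \<open>s\<close> has at most
  \<open>n + 1\<close> nodes of length \<open>2 ^ n\<close>, each with fewer than \<open>n\<^sup>2\<close> ones. But \<open>s\<close> is splitting, so all but a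
  constant number of the positions below \<open>2 ^ n\<close> carry a one in some node of \<open>s\<close>, whence
  \<open>2 ^ n \<le> k + (n + 1) n\<^sup>2\<close>, which fails for large \<open>n\<close>.
\<close>

section \<open>Nodes of splitting trees\<close>

lemma SP_prefix_closed:
  assumes "q \<in> SP" "t \<in> q" "prefix s t"
  shows "s \<in> q"
  using assms by (auto simp: SP_def is_tree_def)

lemma SP_Nil:
  assumes "q \<in> SP"
  shows "[] \<in> q"
  using assms by (auto simp: SP_def is_tree_def)

lemma SP_splitting:
  assumes "q \<in> SP" "t \<in> q"
  obtains k where
    "\<And>n i. k \<le> n \<Longrightarrow> \<exists>t'\<in>q. prefix t t' \<and> n < length t' \<and> t' ! n = i"
  using assms unfolding SP_def by blast

lemma SP_extend:
  assumes "q \<in> SP" "t \<in> q"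
  obtains t' where "t' \<in> q" "prefix t t'" "l \<le> length t'"
proof -
  obtain k where k: "\<And>n i. k \<le> n \<Longrightarrow> \<exists>t'\<in>q. prefix t t' \<and> n < length t' \<and> t' ! n = i"
    using SP_splitting[OF assms] by blast
  from k[of "max k l" True] that show thesis by force
qed

lemma SP_extend_Lev:
  assumes "q \<in> SP" "t \<in> q" "length t \<le> l"
  obtains t' where "t' \<in> Lev l q" "prefix t t'"
proof -
  obtain u where u: "u \<in> q" "prefix t u" "l \<le> length u"
    using SP_extend[OF assms(1,2)] .
  have "take l u \<in> q"
    using SP_prefix_closed[OF assms(1) u(1)] take_is_prefix by blast
  moreover have "prefix t (take l u)"
    using u(2) assms(3) by (auto simp: prefix_def)
  ultimately show thesis
    using u(3) by (intro that) (auto simp: Lev_def)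
qed

lemma SP_Lev_nonempty:
  assumes "q \<in> SP"
  obtains t where "t \<in> Lev l q"
  using SP_extend_Lev[OF assms SP_Nil[OF assms], of l] by auto

text \<open>Splitting at the root \<open>[]\<close> supplies, for each large \<open>n\<close>, a
  node with a one at \<open>n\<close>; extending it and cutting at length \<open>l\<close> keeps
  that one. The point is that \<open>k\<close> does not depend on \<open>l\<close>.\<close>

lemma SP_eventually_ones:
  assumes "q \<in> SP"
  obtains k where "\<And>l. {k..<l} \<subseteq> (\<Union>t\<in>Lev l q. ones t)"
proof -
  obtain k where k: "\<And>n i. k \<le> n \<Longrightarrow> \<exists>t'\<in>q. prefix [] t' \<and> n < length t' \<and> t' ! n = i"
    using SP_splitting[OF assms SP_Nil[OF assms]] by blast
  have "n \<in> (\<Union>t\<in>Lev l q. ones t)" if n: "k \<le> n" "n < l" for n l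
  proof -
    obtain t where t: "t \<in> q" "n < length t" "t ! n"
      using k[of n True] n by auto
    obtain u where u: "u \<in> q" "prefix t u" "l \<le> length u"
      using SP_extend[OF assms t(1)] .
    have "u ! n"
      using t u(2) by (auto simp: prefix_def nth_append)
    then have "n \<in> ones (take l u)"
      using n u(3) by (simp add: ones_def)
    moreover have "take l u \<in> Lev l q"
      using SP_prefix_closed[OF assms u(1)] take_is_prefix u(3) by (auto simp: Lev_def)
    ultimately show ?thesis by blast
  qed
  then show thesis by (intro that) auto
qed

lemma finite_Lev: "finite (Lev l q)"
  using finite_lists_length_eq[of "UNIV :: bool set" l]
  by (rule rev_finite_subset) (auto simp: Lev_def)

section \<open>Restriction to a node\<close>

definition cone :: "bool list \<Rightarrow> bool list set" where
  "cone t = {s. prefix s t \<or> prefix t s}"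

lemma cone_same_length:
  assumes "t \<in> cone s" "length t = length s"
  shows "t = s"
  using assms by (auto simp: cone_def prefix_def)

lemma SP_restrict:
  assumes "q \<in> SP" "t \<in> q"
  shows "q \<inter> cone t \<in> SP"
proof -
  have "is_tree (q \<inter> cone t)"
    unfolding is_tree_def
  proof (intro conjI ballI allI impI)
    show "q \<inter> cone t \<noteq> {}"
      using assms(2) by (auto simp: cone_def)
  next
    fix u s
    assume u: "u \<in> q \<inter> cone t" and s: "prefix s u"
    have "s \<in> cone t"
      using u s prefix_same_cases[of s u t] unfolding cone_def
      by (auto intro: prefix_order.trans)
    then show "s \<in> q \<inter> cone t"
      using u s SP_prefix_closed[OF assms(1)] by blast
  qed
  moreover have "\<exists>k. \<forall>n\<ge>k. \<forall>i. \<exists>t'\<in>q \<inter> cone t. prefix u t' \<and> n < length t' \<and> t' ! n = i"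
    if u: "u \<in> q \<inter> cone t" for u
  proof -
    \<comment> \<open>\<open>v\<close> is the longer of the comparable nodes \<open>u\<close> and
      \<open>t\<close>: all its extensions pass through \<open>t\<close>, so splitting of
      \<open>q\<close> above \<open>v\<close> stays inside the cone.\<close>
    obtain v where v: "v \<in> q" "prefix u v" "prefix t v"
      using u assms(2) unfolding cone_def by blast
    obtain k where "\<And>n i. k \<le> n \<Longrightarrow> \<exists>t'\<in>q. prefix v t' \<and> n < length t' \<and> t' ! n = i"
      using SP_splitting[OF assms(1) v(1)] by blast
    moreover have "prefix u t' \<and> t' \<in> cone t" if "prefix v t'" for t'
      using v that by (auto simp: cone_def intro: prefix_order.trans)
    ultimately show ?thesis by (meson IntI)
  qed
  ultimately show ?thesis by (simp add: SP_def)
qed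

text \<open>Splitting trees have nodes of every length, and \<open>cone s\<close> has only
  \<open>s\<close> at length \<open>length s\<close>. Hence no condition can decide an initial
  segment of the generic branch in two ways.\<close>

lemma SP_cone_unique:
  assumes "q \<in> SP" "q \<subseteq> cone s" "q \<subseteq> cone t" "length s = length t"
  shows "s = t"
proof -
  obtain u where "u \<in> q" "length u = length s"
    using SP_Lev_nonempty[OF assms(1)] unfolding Lev_def by blast
  then show ?thesis
    using assms cone_same_length[of u s] cone_same_length[of u t] by auto
qed

section \<open>The name for the initial segments of the generic branch\<close>

abbreviation below :: "bool list set \<Rightarrow> bool list set set" where
  "below p \<equiv> {q \<in> SP. q \<subseteq> p}"

text \<open>A condition inside \<open>cone t\<close> forces the generic branch through
  \<open>t\<close>; \<open>to_nat\<close> codes this segment as a natural number. At length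
  \<open>2 ^ n\<close> the bound on the number of ones becomes \<open>n\<^sup>2\<close>.\<close>

definition branch_name :: "bool list set \<Rightarrow> bool list set nice_name" where
  "branch_name p = {((n, to_nat t), q) | n t q. q \<in> below p \<and> length t = 2 ^ n \<and> q \<subseteq> cone t}"

lemma forces_branch_nameI:
  assumes "q \<in> below p" "length t = 2 ^ n" "q \<subseteq> cone t"
  shows "forces_value (below p) (\<subseteq>) (branch_name p) n (to_nat t) q"
  unfolding forces_value_def branch_name_def using assms by blast

lemma forces_branch_nameE:
  assumes "forces_value (below p) (\<subseteq>) (branch_name p) n m q" "r \<in> below p" "r \<subseteq> q"
  obtains s t where "s \<in> below p" "s \<subseteq> r" "m = to_nat t" "length t = 2 ^ n" "s \<subseteq> cone t"
proof -
  obtain s u where "s \<in> below p" "s \<subseteq> r" "s \<subseteq> u" "((n, m), u) \<in> branch_name p"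
    using assms unfolding forces_value_def by meson
  then show thesis
    using that unfolding branch_name_def by blast
qed

lemma real_name_branch_name: "real_name (below p) (\<subseteq>) (branch_name p)"
  unfolding real_name_def forces_Ball_def forces_Bex_def forces_Not_def forces_And_def
proof (intro conjI ballI impI)
  show "branch_name p \<subseteq> UNIV \<times> below p"
    by (auto simp: branch_name_def)
next
  fix n q r
  assume "r \<in> below p"
  then have r: "r \<in> SP" "r \<subseteq> p" by auto
  obtain t where t: "t \<in> r" "length t = 2 ^ n"
    using SP_Lev_nonempty[OF r(1)] unfolding Lev_def by blast
  let ?s = "r \<inter> cone t"
  have s: "?s \<in> below p"
    using SP_restrict[OF r(1) t(1)] r(2) by blast
  have "forces_value (below p) (\<subseteq>) (branch_name p) n (to_nat t) ?s"
    using forces_branch_nameI[OF s t(2)] by blast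
  then show "\<exists>s\<in>below p. s \<subseteq> r \<and>
      (\<exists>m\<in>UNIV. forces_value (below p) (\<subseteq>) (branch_name p) n m s)"
    using s by blast
next
  have False
    if r: "r \<in> below p" and "m \<noteq> m'"
      and m: "forces_value (below p) (\<subseteq>) (branch_name p) n m r"
      and m': "forces_value (below p) (\<subseteq>) (branch_name p) n m' r"
    for n m m' r
  proof -
    obtain s t where s: "s \<in> below p" "s \<subseteq> r" "m = to_nat t" "length t = 2 ^ n" "s \<subseteq> cone t"
      using forces_branch_nameE[OF m r order_refl] .
    \<comment> \<open>The second value is decided below \<open>s\<close>, so that \<open>s'\<close>
      lies in both cones.\<close>
    obtain s' t' where s': "s' \<in> below p" "s' \<subseteq> s" "m' = to_nat t'" "length t' = 2 ^ n" "s' \<subseteq> cone t'"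
      using forces_branch_nameE[OF m' s(1,2)] .
    have "t = t'"
      using s s' by (intro SP_cone_unique[of s']) auto
    with \<open>m \<noteq> m'\<close> s s' show ?thesis by simp
  qed
  then show "(case x of (m, m') \<Rightarrow> \<lambda>q. \<forall>r\<in>below p. r \<subseteq> q \<longrightarrow>
      \<not> (forces_value (below p) (\<subseteq>) (branch_name p) n m r \<and>
         forces_value (below p) (\<subseteq>) (branch_name p) n m' r)) q"
    if "x \<in> {(m, m'). m \<noteq> m'}" for x n q
    using that by (cases x) blast
qed

text \<open>Every node \<open>t\<close> of \<open>s\<close> of length \<open>2 ^ n\<close> is a
  possible value: some condition below \<open>s \<inter> cone t\<close> decides the value to lie in
  \<open>A\<close>, and in that cone it can only be \<open>to_nat t\<close>.\<close>

lemma captured_Lev: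
  assumes "s \<in> below p"
    and "forces_Bex (below p) (\<subseteq>) A (forces_value (below p) (\<subseteq>) (branch_name p) n) s"
  shows "to_nat ` Lev (2 ^ n) s \<subseteq> A"
proof safe
  fix t
  assume "t \<in> Lev (2 ^ n) s"
  then have t: "t \<in> s" "length t = 2 ^ n"
    by (auto simp: Lev_def)
  have "s \<inter> cone t \<in> below p"
    using SP_restrict[of s t] assms(1) t(1) by blast
  then obtain s' m where s': "s' \<in> below p" "s' \<subseteq> s \<inter> cone t" "m \<in> A"
    "forces_value (below p) (\<subseteq>) (branch_name p) n m s'"
    using assms(2) unfolding forces_Bex_def by (meson inf_le1)
  obtain s'' t' where "s'' \<in> below p" "s'' \<subseteq> s'" "m = to_nat t'" "length t' = 2 ^ n" "s'' \<subseteq> cone t'"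
    using forces_branch_nameE[OF s'(4,1)] by blast
  then have "t' = t"
    using s' t by (intro SP_cone_unique[of s'']) auto
  with \<open>m = to_nat t'\<close> \<open>m \<in> A\<close> show "to_nat t \<in> A" by simp
qed

section \<open>The Sacks property fails\<close>

theorem theorem9p13:
  fixes p :: "bool list set"
  assumes "p \<in> SP"
    and "\<forall>q\<in>SP. q \<subseteq> p \<longrightarrow>
      (\<forall>\<^sub>F l in sequentially. \<forall>t\<in>Lev l q. real (card (ones t)) < (log 2 (real l))\<^sup>2)"
  shows "\<not> Sacks_property {q \<in> SP. q \<subseteq> p} (\<lambda>q r. q \<subseteq> r)"
proof
  assume sacks: "Sacks_property (below p) (\<subseteq>)"
  \<comment> \<open>\<open>Suc\<close> is nonzero and unbounded, yet
    \<open>Suc n * n\<^sup>2\<close> stays far below \<open>2 ^ n\<close>.\<close>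
  have "filterlim Suc at_top sequentially"
    by (rule filterlim_Suc)
  then obtain S q where S: "slalom Suc S" and q: "q \<in> below p"
    and "forces_almost_all_in (below p) (\<subseteq>) (branch_name p) S q"
    using sacks real_name_branch_name[of p] assms(1) unfolding Sacks_property_def by blast
  \<comment> \<open>Fixing the threshold \<open>N\<close> requires passing from \<open>q\<close> to
    a stronger \<open>s\<close>. Only this quantifier is unfolded (\<open>A = UNIV\<close>); the one
    over \<open>S n\<close> keeps the form used by \<open>captured_Lev\<close>.\<close>
  then have "\<exists>s\<in>below p. s \<subseteq> q \<and> (\<exists>N\<in>UNIV. \<forall>n\<in>{N..}.
      forces_Bex (below p) (\<subseteq>) (S n) (forces_value (below p) (\<subseteq>) (branch_name p) n) s)"
    unfolding forces_almost_all_in_def forces_Bex_def[where A = UNIV] forces_Ball_def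
    using q by blast
  then obtain s N where s: "s \<in> below p"
    and captured: "\<forall>n\<in>{N..}.
      forces_Bex (below p) (\<subseteq>) (S n) (forces_value (below p) (\<subseteq>) (branch_name p) n) s"
    by blast
  have "card (Lev (2 ^ n) s) \<le> Suc n" if "N \<le> n" for n
  proof -
    have "card (Lev (2 ^ n) s) \<le> card (S n)"
      using captured_Lev[OF s] captured that S
      by (intro card_inj_on_le[where f = to_nat]) (auto simp: slalom_def)
    also have "\<dots> \<le> Suc n"
      using S by (simp add: slalom_def)
    finally show ?thesis .
  qed
  then have width: "\<forall>\<^sub>F n in sequentially. card (Lev (2 ^ n) s) \<le> Suc n"
    unfolding eventually_sequentially by blast
  \<comment> \<open>The sparseness hypothesis is applied to \<open>s\<close> itself and then pulled
    back along \<open>l = 2 ^ n\<close>.\<close>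
  have "\<forall>\<^sub>F l in sequentially. \<forall>t\<in>Lev l s. real (card (ones t)) < (log 2 (real l))\<^sup>2"
    using assms(2) s by blast
  moreover have "filterlim (\<lambda>n. 2 ^ n :: nat) sequentially sequentially"
    by (rule filterlim_subseq) (simp add: strict_mono_def)
  ultimately have "\<forall>\<^sub>F n in sequentially. \<forall>t\<in>Lev (2 ^ n) s.
      real (card (ones t)) < (log 2 (real (2 ^ n)))\<^sup>2"
    by (rule eventually_compose_filterlim)
  then have sparse: "\<forall>\<^sub>F n in sequentially. \<forall>t\<in>Lev (2 ^ n) s. card (ones t) \<le> n\<^sup>2"
  proof eventually_elim
    case (elim n)
    have "log 2 (real (2 ^ n)) = real n"
      by (simp add: log_nat_power)
    with elim have "\<forall>t\<in>Lev (2 ^ n) s. real (card (ones t)) < real (n\<^sup>2)"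
      by simp
    then show ?case
      by (simp only: of_nat_less_iff) (simp add: less_imp_le)
  qed
  obtain k where k: "\<And>l. {k..<l} \<subseteq> (\<Union>t\<in>Lev l s. ones t)"
    using SP_eventually_ones s by blast
  have "\<forall>\<^sub>F n in sequentially. real k + (real n + 1) * (real n)\<^sup>2 < 2 ^ n"
    by real_asymp
  with width sparse have "\<forall>\<^sub>F n :: nat in sequentially. False"
  proof eventually_elim
    case (elim n)
    \<comment> \<open>Subtraction is truncated here, which is harmless: the final bound moves
      \<open>k\<close> to the other side.\<close>
    have "2 ^ n - k = card {k..<2 ^ n}"
      by simp
    also have "\<dots> \<le> card (\<Union>t\<in>Lev (2 ^ n) s. ones t)"
      using k by (intro card_mono) (auto simp: finite_Lev ones_def)
    also have "\<dots> \<le> (\<Sum>t\<in>Lev (2 ^ n) s. card (ones t))"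
      by (rule card_UN_le[OF finite_Lev])
    also have "\<dots> \<le> card (Lev (2 ^ n) s) * n\<^sup>2"
      using elim(2) sum_bounded_above[of "Lev (2 ^ n) s" "\<lambda>t. card (ones t)" "n\<^sup>2"] by simp
    also have "\<dots> \<le> Suc n * n\<^sup>2"
      using elim(1) by (rule mult_le_mono1)
    finally have "2 ^ n \<le> k + Suc n * n\<^sup>2"
      by simp
    then have "real (2 ^ n) \<le> real (k + Suc n * n\<^sup>2)"
      by (rule of_nat_mono)
    with elim(3) show ?case by (simp add: algebra_simps)
  qed
  then show False by simp
qed

end
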